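(* Let $H$ be a complex Hilbert space and let $P\in\mathcal{B}(H)$ be a selfadjoint operator with $P\ge 0$, i.e. $\langle Px,x\rangle\ge 0$ for all $x\in H$. (i) For any $A,B\in\mathcal{B}_2(H)$, $$\left|\operatorname{tr}(PAB^* )\right|^2\le \operatorname{tr}(P|A^*|^2)\,\operatorname{tr}(P|B^*|^2)$$ and $$\left[\operatorname{tr}(P|A^*|^2)+2\operatorname{Re}\operatorname{tr}(PAB^* )+\operatorname{tr}(P|B^*|^2)\right]^{1/2}\le \left[\operatorname{tr}(P|A^*|^2)\right]^{1/2}+\left[\operatorname{tr}(P|B^*|^2)\right]^{1/2}.$$ (ii) For any $A,B,C\in\mathcal{B}_2(H)$, $$\left|\operatorname{tr}(PAB^* )\operatorname{tr}(P|C^*|^2)-\operatorname{tr}(PAC^* )\operatorname{tr}(PCB^* )\right|^2$$ $$\le\left[\operatorname{tr}(P|A^*|^2)\operatorname{tr}(P|C^*|^2)-|\operatorname{tr}(PAC^* )|^2\right]\left[\operatorname{tr}(P|B^*|^2)\operatorname{tr}(P|C^*|^2)-|\operatorname{tr}(PBC^* )|^2\right],$$ $$|\operatorname{tr}(PAB^* )|\operatorname{tr}(P|C^*|^2)\le\left|\operatorname{tr}(PAB^* )\operatorname{tr}(P|C^*|^2)-\operatorname{tr}(PAC^* )\operatorname{tr}(PCB^* )\right|+\left|\operatorname{tr}(PAC^* )\operatorname{tr}(PCB^* )\right|$$ $$\le\left[\operatorname{tr}(P|A^*|^2)\right]^{1/2}\left[\operatorname{tr}(P|B^*|^2)\right]^{1/2}\operatorname{tr}(P|C^*|^2),$$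 and $$\left|\operatorname{tr}(PAC^* )\operatorname{tr}(PCB^* )\right|\le\frac12\left[\left[\operatorname{tr}(P|A^*|^2)\right]^{1/2}\left[\operatorname{tr}(P|B^*|^2)\right]^{1/2}+|\operatorname{tr}(PAB^* )|\right]\operatorname{tr}(P|C^*|^2).$$
   Context: $\mathcal{B}(H)$ is the algebra of bounded linear operators on $H$. $\mathcal{B}_2(H)$ is the set of Hilbert-Schmidt operators, i.e. $A\in\mathcal{B}(H)$ with $\sum_{i\in I}\|Ae_i\|^2<\infty$ for an (equivalently every) orthonormal basis $\{e_i\}_{i\in I}$ of $H$. $|A|:=(A^*A)^{1/2}$ is the modulus of $A$ (so $|A^*|^2=AA^*$). $\mathcal{B}_1(H)$ is the set of trace class operators, i.e. $A\in\mathcal{B}(H)$ with $\sum_{i\in I}\langle |A|e_i,e_i\rangle<\infty$, and $\operatorname{tr}(A)=\sum_{i\in I}\langle Ae_i,e_i\rangle$ for $A\in\mathcal{B}_1(H)$. The product of two Hilbert-Schmidt operators is trace class, and so is the product of a bounded and a trace class operator. *)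

theory Defs
  imports "HOL-Analysis.Analysis"
begin

text \<open>
  Complex inner product spaces, linear in the first argument. The class extends
  \<^class>\<open>real_inner\<close>: the real inner product is forced to be the real part of the complex one,
  so that \<open>norm x = sqrt (Re (cinner x x))\<close>, and no generality is lost.
\<close>

class complex_inner = real_inner +
  fixes scaleC :: "complex \<Rightarrow> 'a \<Rightarrow> 'a" (infixr "*\<^sub>C" 75)
    and cinner :: "'a \<Rightarrow> 'a \<Rightarrow> complex"
  assumes scaleC_add_right: "c *\<^sub>C (x + y) = c *\<^sub>C x + c *\<^sub>C y"
    and scaleC_add_left: "(c + d) *\<^sub>C x = c *\<^sub>C x + d *\<^sub>C x"
    and scaleC_scaleC: "c *\<^sub>C (d *\<^sub>C x) = (c * d) *\<^sub>C x"
    and scaleR_scaleC: "r *\<^sub>R x = complex_of_real r *\<^sub>C x"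
    and cinner_add_left: "cinner (x + y) z = cinner x z + cinner y z"
    and cinner_scaleC_left: "cinner (c *\<^sub>C x) y = c * cinner x y"
    and cinner_commute: "cinner x y = cnj (cinner y x)"
    and inner_eq_Re_cinner: "inner x y = Re (cinner x y)"

class complex_hilbert = complex_inner + complete_space

instantiation complex :: complex_hilbert
begin

definition scaleC_complex :: "complex \<Rightarrow> complex \<Rightarrow> complex" where
  "scaleC_complex c x = c * x"

definition cinner_complex :: "complex \<Rightarrow> complex \<Rightarrow> complex" where
  "cinner_complex x y = x * cnj y"

instance
  by standard
    (auto simp: scaleC_complex_def cinner_complex_def inner_complex_def scaleR_conv_of_real
      algebra_simps)

end

global_interpretation complex_vector:
  vector_space "scaleC :: complex \<Rightarrow> 'a \<Rightarrow> 'a::complex_inner"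
proof
  show "1 *\<^sub>C x = x" for x :: 'a
    using scaleR_scaleC[of 1 x] by simp
qed (simp_all add: scaleC_add_right scaleC_add_left scaleC_scaleC)

definition orthonormal_basis :: "'a::complex_inner set \<Rightarrow> bool" where
  "orthonormal_basis E \<longleftrightarrow>
     (\<forall>e\<in>E. \<forall>f\<in>E. cinner e f = (if e = f then 1 else 0)) \<and>
     closure (complex_vector.span E) = UNIV"

definition bounded_clinear :: "('a::complex_inner \<Rightarrow> 'a) \<Rightarrow> bool" where
  "bounded_clinear A \<longleftrightarrow> bounded_linear A \<and> (\<forall>c x. A (c *\<^sub>C x) = c *\<^sub>C A x)"

definition cadjoint :: "('a::complex_inner \<Rightarrow> 'a) \<Rightarrow> 'a \<Rightarrow> 'a" where
  "cadjoint A = (SOME B. \<forall>x y. cinner (A x) y = cinner x (B y))"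

text \<open>For a selfadjoint \<open>P\<close> the number \<open>cinner (P x) x\<close> is real, so taking its real part
  below discards nothing.\<close>

definition positive_op :: "('a::complex_inner \<Rightarrow> 'a) \<Rightarrow> bool" where
  "positive_op P \<longleftrightarrow>
     bounded_clinear P \<and> cadjoint P = P \<and> (\<forall>x. 0 \<le> Re (cinner (P x) x))"

text \<open>On a Hilbert space the positive square root of a positive operator exists and is unique.\<close>

definition sqrt_op :: "('a::complex_inner \<Rightarrow> 'a) \<Rightarrow> 'a \<Rightarrow> 'a" where
  "sqrt_op T = (SOME S. positive_op S \<and> S \<circ> S = T)"

definition modulus :: "('a::complex_inner \<Rightarrow> 'a) \<Rightarrow> 'a \<Rightarrow> 'a" where
  "modulus A = sqrt_op (cadjoint A \<circ> A)"

definition hilbert_schmidt :: "('a::complex_inner \<Rightarrow> 'a) set" where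
  "hilbert_schmidt =
     {A. bounded_clinear A \<and>
         (\<exists>E. orthonormal_basis E \<and> (\<lambda>e. (norm (A e))\<^sup>2) summable_on E)}"

text \<open>Every Hilbert space has an orthonormal basis, and for trace class operators the sum below
  converges and does not depend on the basis chosen. Outside the trace class the value of
  \<open>trace_op\<close> has no meaning. For positive \<open>P\<close> and Hilbert-Schmidt \<open>A\<close>, the trace of
  \<open>P \<circ> A \<circ> cadjoint A\<close> equals that of \<open>cadjoint A \<circ> P \<circ> A\<close> and is hence a nonnegative real,
  so it may be compared with reals through \<open>Re\<close>.\<close>

definition trace_op :: "('a::complex_inner \<Rightarrow> 'a) \<Rightarrow> complex" where
  "trace_op A = (\<Sum>\<^sub>\<infinity>e\<in>(SOME E. orthonormal_basis E). cinner (A e) e)"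

end

theory Submission
  imports Defs "HOL-Computational_Algebra.Formal_Power_Series"
begin

text \<open>
  For an orthonormal basis \<open>E\<close>, Parseval's identity and absolute convergence of the double sum
  \<open>\<Sum>\<^sub>e \<Sum>\<^sub>f \<langle>P A f, e\<rangle> \<langle>e, B f\<rangle>\<close> give \<open>tr (P A B\<^sup>*) = \<Sum>\<^sub>f \<langle>P A f, B f\<rangle>\<close>. Hence
  \<open>(A, B) \<mapsto> tr (P A B\<^sup>*)\<close> is a positive semidefinite Hermitian form on the Hilbert-Schmidt operators,
  and the inequalities are Cauchy-Schwarz, the triangle inequality, Cauchy-Schwarz for the components
  of \<open>A\<close> and \<open>B\<close> orthogonal to \<open>C\<close>, and the resulting refinements of Dragomir and Buzano type.
  To identify \<open>|A\<^sup>*|\<^sup>2\<close> with \<open>A A\<^sup>*\<close>, square roots are obtained from the binomial series of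
  \<open>sqrt (1 - x)\<close>, which converges absolutely at contractions; adjoints come from expanding in \<open>E\<close>,
  which exists as soon as there is a Hilbert-Schmidt operator.
\<close>

text \<open>Completeness is used in this form when the absolutely summable operator series below are
  summed.\<close>

instance complex_hilbert \<subseteq> banach ..

subsection \<open>Complex inner products\<close>

lemma cinner_add_right: "cinner x (y + z) = cinner x y + cinner (x::'a::complex_inner) z"
  by (metis cinner_add_left cinner_commute complex_cnj_add)

lemma cinner_scaleC_right: "cinner x (c *\<^sub>C y) = cnj c * cinner (x::'a::complex_inner) y"
  by (metis cinner_commute cinner_scaleC_left complex_cnj_mult)

lemma cinner_scaleR_left: "cinner (r *\<^sub>R x) y = of_real r * cinner (x::'a::complex_inner) y"
  by (simp add: scaleR_scaleC cinner_scaleC_left)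

lemma cinner_scaleR_right: "cinner x (r *\<^sub>R y) = of_real r * cinner (x::'a::complex_inner) y"
  by (simp add: scaleR_scaleC cinner_scaleC_right)

lemma cinner_self: "cinner x x = of_real ((norm (x::'a::complex_inner))\<^sup>2)"
proof -
  have "Im (cinner x x) = 0"
    using arg_cong[OF cinner_commute[of x x], of Im] by simp
  then show ?thesis
    by (simp add: complex_eq_iff power2_norm_eq_inner inner_eq_Re_cinner)
qed

lemma norm_scaleC: "norm (c *\<^sub>C x) = cmod c * norm (x::'a::complex_inner)"
proof -
  have "of_real ((norm (c *\<^sub>C x))\<^sup>2) = c * cnj c * of_real ((norm x)\<^sup>2)"
    unfolding cinner_self[symmetric] by (simp add: cinner_scaleC_left cinner_scaleC_right)
  also have "\<dots> = of_real ((cmod c * norm x)\<^sup>2)"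
    by (simp add: complex_norm_square[symmetric] power_mult_distrib)
  finally have "(norm (c *\<^sub>C x))\<^sup>2 = (cmod c * norm x)\<^sup>2"
    by (simp only: of_real_eq_iff)
  then show ?thesis
    by (simp add: power2_eq_iff_nonneg)
qed

text \<open>A factor \<open>c\<close> of modulus 1 rotates \<open>cinner x y\<close> onto the
  nonnegative reals, where it agrees with the real inner product. The real Cauchy-Schwarz inequality
  then applies.\<close>

lemma norm_cinner_le: "cmod (cinner x y) \<le> norm x * norm (y::'a::complex_inner)"
proof (cases "cinner x y = 0")
  case False
  define c where "c = cnj (cinner x y) / cmod (cinner x y)"
  have c: "cmod c = 1" "c * cinner x y = cmod (cinner x y)"
    using False complex_norm_square[of "cinner x y"]
    by (auto simp: c_def norm_divide field_simps power2_eq_square)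
  have "cmod (cinner x y) = inner (c *\<^sub>C x) y"
    by (simp add: inner_eq_Re_cinner cinner_scaleC_left c)
  also have "\<dots> \<le> norm (c *\<^sub>C x) * norm y"
    by (rule norm_cauchy_schwarz)
  finally show ?thesis
    by (simp add: norm_scaleC c)
qed simp

lemma norm_cinner_commute: "cmod (cinner x y) = cmod (cinner y (x::'a::complex_inner))"
  by (subst cinner_commute) simp

lemma bounded_linear_cinner_left: "bounded_linear (\<lambda>x. cinner x (y::'a::complex_inner))"
  by (rule bounded_linear_intro[where K = "norm y"])
    (simp_all add: cinner_add_left cinner_scaleR_left scaleR_conv_of_real norm_cinner_le)

lemma bounded_linear_cinner_right: "bounded_linear (\<lambda>y. cinner (x::'a::complex_inner) y)"
  by (rule bounded_linear_intro[where K = "norm x"])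
    (simp_all add: cinner_add_right cinner_scaleR_right scaleR_conv_of_real norm_cinner_le
      mult.commute[of "norm _" "norm x"])

lemmas cinner_diff_left = linear_simps(2)[OF bounded_linear_cinner_left]
lemmas cinner_diff_right = linear_simps(2)[OF bounded_linear_cinner_right]
lemmas cinner_sum_left = linear_sum[OF bounded_linear.linear[OF bounded_linear_cinner_left]]
lemmas cinner_sum_right = linear_sum[OF bounded_linear.linear[OF bounded_linear_cinner_right]]

lemma cinner_ext:
  fixes x y :: "'a::complex_inner"
  assumes "\<And>z. cinner z x = cinner z y"
  shows "x = y"
proof -
  have "cinner (x - y) (x - y) = 0"
    using assms by (simp add: cinner_diff_right)
  then show ?thesis
    by (simp add: cinner_self)
qed

lemma bounded_linear_scaleC: "bounded_linear (\<lambda>x::'a::complex_inner. c *\<^sub>C x)"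
  by (rule bounded_linear_intro[where K = "cmod c"])
    (simp_all add: scaleC_add_right scaleR_scaleC scaleC_scaleC norm_scaleC mult.commute)

lemma bounded_clinearD:
  assumes "bounded_clinear A"
  shows "bounded_linear A" "A (c *\<^sub>C x) = c *\<^sub>C A x"
  using assms by (auto simp: bounded_clinear_def)

lemma bounded_clinear_bound:
  assumes "bounded_clinear A"
  obtains K where "K > 0" "\<And>x. norm (A x) \<le> K * norm x"
  using bounded_linear.pos_bounded[OF bounded_clinearD(1)[OF assms]]
  by (auto simp: mult.commute)

lemma bounded_clinear_compose:
  assumes "bounded_clinear A" "bounded_clinear B"
  shows "bounded_clinear (A \<circ> B)"
  using assms bounded_linear_compose[of A B] by (auto simp: bounded_clinear_def o_def)

lemma bounded_clinear_lincomb: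
  assumes "bounded_clinear A" "bounded_clinear B"
  shows "bounded_clinear (\<lambda>x. a *\<^sub>C A x + b *\<^sub>C B x)"
  using assms bounded_linear_add[OF bounded_linear_compose[OF bounded_linear_scaleC]
      bounded_linear_compose[OF bounded_linear_scaleC], of A B]
  by (auto simp: bounded_clinear_def scaleC_add_right scaleC_scaleC mult.commute)

subsection \<open>Orthonormal expansions\<close>

lemma orthonormal_basisD:
  assumes "orthonormal_basis E" "e \<in> E" "f \<in> E"
  shows "cinner e f = (if e = f then 1 else 0)"
  using assms by (auto simp: orthonormal_basis_def)

lemma norm_sum_orthonormal:
  assumes "orthonormal_basis E" "finite F" "F \<subseteq> E"
  shows "(norm (\<Sum>e\<in>F. g e *\<^sub>C e))\<^sup>2 = (\<Sum>e\<in>F. (cmod (g e))\<^sup>2)"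
proof -
  have "cinner (\<Sum>e\<in>F. g e *\<^sub>C e) (\<Sum>e\<in>F. g e *\<^sub>C e)
      = (\<Sum>e\<in>F. \<Sum>f\<in>F. cnj (g f) * (g e * cinner e f))"
    by (subst sum.swap) (simp add: cinner_sum_left cinner_sum_right cinner_scaleC_left
        cinner_scaleC_right sum_distrib_left mult.left_commute)
  also have "\<dots> = (\<Sum>e\<in>F. \<Sum>f\<in>F. if f = e then cnj (g e) * g e else 0)"
    using assms by (intro sum.cong refl) (auto simp: orthonormal_basisD[OF assms(1)] subset_iff)
  also have "\<dots> = (\<Sum>e\<in>F. cnj (g e) * g e)"
    using assms by (intro sum.cong refl) (simp add: sum.delta)
  also have "\<dots> = of_real (\<Sum>e\<in>F. (cmod (g e))\<^sup>2)"
    by (simp add: complex_norm_square mult.commute del: of_real_power)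
  finally show ?thesis
    unfolding cinner_self by (simp only: of_real_eq_iff)
qed

text \<open>Best approximation: density of the span gives a finite combination \<open>y\<close> near
  \<open>x\<close>, and the partial sum over any finite set containing the support of
  \<open>y\<close> is at least as close to \<open>x\<close>.\<close>

lemma orthonormal_basis_expansion:
  assumes E: "orthonormal_basis E"
  shows "((\<lambda>e. cinner x e *\<^sub>C e) has_sum x) E"
  unfolding has_sum_def
proof (rule tendstoI)
  fix \<epsilon> :: real
  assume "\<epsilon> > 0"
  have "x \<in> closure (complex_vector.span E)"
    using E by (simp add: orthonormal_basis_def)
  then obtain y where y: "y \<in> complex_vector.span E" "dist y x < \<epsilon>"
    using \<open>\<epsilon> > 0\<close> closure_approachable by blast
  then obtain t r where t: "finite t" "t \<subseteq> E" "y = (\<Sum>a\<in>t. r a *\<^sub>C a)"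
    unfolding complex_vector.span_explicit by blast
  have "dist (\<Sum>e\<in>F. cinner x e *\<^sub>C e) x < \<epsilon>" if F: "finite F" "t \<subseteq> F" "F \<subseteq> E" for F
  proof -
    define z where "z = x - (\<Sum>e\<in>F. cinner x e *\<^sub>C e)"
    have orth: "cinner z f = 0" if "f \<in> F" for f
    proof -
      have "(\<Sum>e\<in>F. cinner x e * cinner e f) = (\<Sum>e\<in>F. if e = f then cinner x f else 0)"
        using F that by (intro sum.cong refl) (auto simp: orthonormal_basisD[OF E] subset_iff)
      then show ?thesis
        using F that
        by (simp add: z_def cinner_diff_left cinner_sum_left cinner_scaleC_left)
    qed
    \<comment> \<open>The vectors \<open>x - y\<close> and \<open>z\<close> differ by a combination
      of elements of \<open>F\<close>, and \<open>z\<close> is orthogonal to all of these.\<close>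
    have "cinner z (x - y) - cinner z z = cinner z (\<Sum>e\<in>F. cinner x e *\<^sub>C e) - cinner z y"
      by (simp add: z_def cinner_diff_right)
    also have "\<dots> = 0"
      using orth F t by (simp add: cinner_sum_right cinner_scaleC_right subset_iff)
    finally have "(norm z)\<^sup>2 = cmod (cinner z (x - y))"
      by (simp add: cinner_self norm_power)
    also have "\<dots> \<le> norm z * norm (x - y)"
      by (rule norm_cinner_le)
    finally have "norm z \<le> norm (x - y)"
      by (cases "z = 0") (auto simp: power2_eq_square)
    then show ?thesis
      using y by (simp add: z_def dist_norm norm_minus_commute)
  qed
  then show "\<forall>\<^sub>F F in finite_subsets_at_top E. dist (\<Sum>e\<in>F. cinner x e *\<^sub>C e) x < \<epsilon>"
    using t unfolding eventually_finite_subsets_at_top by blast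
qed

lemma parseval_cinner:
  assumes "orthonormal_basis E"
  shows "((\<lambda>e. cinner x e * cinner e y) has_sum cinner x y) E"
  using has_sum_bounded_linear[OF bounded_linear_cinner_left orthonormal_basis_expansion[OF assms], of x y]
  by (simp add: cinner_scaleC_left)

lemma parseval_norm:
  assumes "orthonormal_basis E"
  shows "((\<lambda>e. (cmod (cinner x e))\<^sup>2) has_sum (norm x)\<^sup>2) E"
proof -
  have "((\<lambda>e. complex_of_real ((cmod (cinner x e))\<^sup>2)) has_sum of_real ((norm x)\<^sup>2)) E"
    using parseval_cinner[OF assms, of x x]
    by (simp only: cinner_self complex_norm_square cinner_commute[symmetric])
  then show ?thesis
    by (simp only: has_sum_of_real_iff)
qed

text \<open>Riesz-Fischer. The family is in general not absolutely summable, so the net of partial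
  sums is shown to be Cauchy directly: by Pythagoras, enlarging \<open>F0\<close> to
  \<open>F\<close> moves the sum by a squared distance equal to the sum of \<open>q\<close> over
  \<open>F - F0\<close>.\<close>

lemma summable_on_orthonormal:
  fixes E :: "'a::complex_hilbert set"
  assumes E: "orthonormal_basis E" and "(\<lambda>e. (cmod (g e))\<^sup>2) summable_on E"
  shows "(\<lambda>e. g e *\<^sub>C e) summable_on E"
proof -
  define f where "f = (\<lambda>e. g e *\<^sub>C e)"
  define q where "q = (\<lambda>e. (cmod (g e))\<^sup>2)"
  obtain L where L: "(q has_sum L) E"
    using assms(2) by (auto simp: summable_on_def q_def)
  have "\<exists>P. eventually P (finite_subsets_at_top E) \<and>
              (\<forall>F F'. P F \<and> P F' \<longrightarrow> dist (sum f F) (sum f F') < \<epsilon>)" if "\<epsilon> > 0" for \<epsilon>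
  proof -
    have "(\<epsilon> / 3)\<^sup>2 > 0" using that by simp
    then obtain F0 where F0: "finite F0" "F0 \<subseteq> E" "dist (sum q F0) L \<le> (\<epsilon> / 3)\<^sup>2"
      using has_sum_finite_approximation[OF L] by blast
    define P where "P F \<longleftrightarrow> finite F \<and> F0 \<subseteq> F \<and> F \<subseteq> E" for F
    have near: "dist (sum f F) (sum f F0) \<le> \<epsilon> / 3" if "P F" for F
    proof -
      have F: "finite F" "F0 \<subseteq> F" "F \<subseteq> E"
        using that by (auto simp: P_def)
      have "(dist (sum f F) (sum f F0))\<^sup>2 = (norm (\<Sum>e\<in>F - F0. g e *\<^sub>C e))\<^sup>2"
        using F by (simp add: dist_norm sum_diff f_def)
      also have "\<dots> = sum q (F - F0)"
        using F unfolding q_def by (intro norm_sum_orthonormal[OF E]) auto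
      also have "\<dots> = sum q F - sum q F0"
        using F by (simp add: sum_diff)
      also have "\<dots> \<le> L - sum q F0"
        using finite_sum_le_has_sum[OF L F(1,3)] by (simp add: q_def)
      also have "\<dots> \<le> (\<epsilon> / 3)\<^sup>2"
        using F0 by (simp add: dist_norm)
      finally show ?thesis
        using \<open>\<epsilon> > 0\<close> by (simp add: power2_le_iff_abs_le)
    qed
    have "dist (sum f F) (sum f F') < \<epsilon>" if "P F" "P F'" for F F'
      using near[OF that(1)] near[OF that(2)] dist_triangle2[of "sum f F" "sum f F'" "sum f F0"]
        \<open>\<epsilon> > 0\<close> by linarith
    moreover have "eventually P (finite_subsets_at_top E)"
      unfolding P_def eventually_finite_subsets_at_top using F0 by blast
    ultimately show ?thesis by blast
  qed
  then have "cauchy_filter (filtermap (sum f) (finite_subsets_at_top E))"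
    by (simp add: cauchy_filter_metric_filtermap)
  moreover have "complete (UNIV::'a set)"
    by (meson Cauchy_convergent UNIV_I complete_def convergent_def)
  ultimately obtain s where "(sum f \<longlongrightarrow> s) (finite_subsets_at_top E)"
    using complete_uniform[where S=UNIV] by (force simp add: filterlim_def)
  then have "(f has_sum s) E"
    by (simp add: has_sum_def)
  then show ?thesis
    unfolding f_def by (rule has_sum_imp_summable)
qed

subsection \<open>Adjoints\<close>

text \<open>Riesz representation of the functional that sends \<open>x\<close> to
  \<open>cinner (A x) y\<close>: the representing vector is the orthonormal series with coefficients
  \<open>cinner y (A e)\<close>.\<close>

lemma adjoint_exists:
  fixes A :: "'a::complex_hilbert \<Rightarrow> 'a" and E :: "'a set"
  assumes E: "orthonormal_basis E" and A: "bounded_clinear A"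
  shows "\<exists>B. \<forall>x y. cinner (A x) y = cinner x (B y)"
proof -
  obtain K where K: "K > 0" "\<And>x. norm (A x) \<le> K * norm x"
    using bounded_clinear_bound[OF A] by blast
  have lin: "linear A"
    using bounded_clinearD(1)[OF A] by (rule bounded_linear.linear)
  have "\<exists>w. \<forall>x. cinner (A x) y = cinner x w" for y
  proof -
    define g where "g = (\<lambda>e. cinner y (A e))"
    have bound: "(\<Sum>e\<in>F. (cmod (g e))\<^sup>2) \<le> (K * norm y)\<^sup>2" if F: "finite F" "F \<subseteq> E" for F :: "'a set"
    proof -
      \<comment> \<open>Evaluated at this partial sum, the functional returns the squared norm of
        the sum, so the bound on \<open>A\<close> limits \<open>norm v\<close> uniformly in
        \<open>F\<close>.\<close>
      define v where "v = (\<Sum>e\<in>F. g e *\<^sub>C e)"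
      have v: "(norm v)\<^sup>2 = (\<Sum>e\<in>F. (cmod (g e))\<^sup>2)"
        using norm_sum_orthonormal[OF E F] by (simp add: v_def)
      have "cinner (A v) y = (\<Sum>e\<in>F. g e * cinner (A e) y)"
        by (simp add: v_def linear_sum[OF lin] bounded_clinearD[OF A] cinner_sum_left
            cinner_scaleC_left)
      also have "\<dots> = (\<Sum>e\<in>F. of_real ((cmod (g e))\<^sup>2))"
        unfolding complex_norm_square g_def cinner_commute[of "A _" y] ..
      finally have "cinner (A v) y = of_real ((norm v)\<^sup>2)"
        by (simp add: v)
      then have "(norm v)\<^sup>2 \<le> norm (A v) * norm y"
        using norm_cinner_le[of "A v" y] by (simp add: norm_power)
      also have "\<dots> \<le> K * norm v * norm y"
        by (intro mult_right_mono K) auto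
      finally have "norm v \<le> K * norm y"
        using K by (cases "v = 0") (auto simp: power2_eq_square)
      then show ?thesis
        unfolding v[symmetric] by (intro power_mono) auto
    qed
    have "(\<lambda>e. (cmod (g e))\<^sup>2) summable_on E"
      by (rule nonneg_bdd_above_summable_on) (auto intro!: bdd_aboveI2[where M = "(K * norm y)\<^sup>2"] bound)
    then obtain w where w: "((\<lambda>e. g e *\<^sub>C e) has_sum w) E"
      using summable_on_orthonormal[OF E] by (auto simp: summable_on_def)
    have "cinner (A x) y = cinner x w" for x
    proof (rule has_sum_unique)
      show "((\<lambda>e. cinner x e * cinner (A e) y) has_sum cinner (A x) y) E"
        using has_sum_bounded_linear[OF bounded_linear_compose[OF bounded_linear_cinner_left
              bounded_clinearD(1)[OF A]] orthonormal_basis_expansion[OF E], of x y]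
        by (simp add: bounded_clinearD[OF A] cinner_scaleC_left)
      show "((\<lambda>e. cinner x e * cinner (A e) y) has_sum cinner x w) E"
        using has_sum_bounded_linear[OF bounded_linear_cinner_right w, of x]
        unfolding g_def cinner_scaleC_right cinner_commute[of _ y, symmetric]
        by (simp only: mult.commute)
    qed
    then show ?thesis by blast
  qed
  then show ?thesis by metis
qed

lemma cinner_cadjoint:
  fixes A :: "'a::complex_hilbert \<Rightarrow> 'a" and E :: "'a set"
  assumes "orthonormal_basis E" "bounded_clinear A"
  shows "cinner (A x) y = cinner x (cadjoint A y)"
proof -
  have "\<forall>x y. cinner (A x) y = cinner x (cadjoint A y)"
    unfolding cadjoint_def
    by (rule someI_ex[of "\<lambda>B. \<forall>x y. cinner (A x) y = cinner x (B y)"])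
      (rule adjoint_exists[OF assms])
  then show ?thesis by blast
qed

text \<open>The given \<open>B\<close> witnesses the choice inside \<open>cadjoint\<close>, and two
  adjoints of one map agree by \<open>cinner_ext\<close>.\<close>

lemma cadjoint_eqI:
  assumes "\<And>x y. cinner (A x) y = cinner x (B y)"
  shows "cadjoint A = B"
proof -
  have "\<forall>x y. cinner (A x) y = cinner x (cadjoint A y)"
    unfolding cadjoint_def
    by (rule someI[of "\<lambda>B. \<forall>x y. cinner (A x) y = cinner x (B y)" B]) (simp add: assms)
  then have "cinner x (cadjoint A y) = cinner x (B y)" for x y
    using assms by simp
  then show ?thesis
    using cinner_ext by blast
qed

lemma bounded_clinear_cadjoint:
  fixes A :: "'a::complex_hilbert \<Rightarrow> 'a" and E :: "'a set"
  assumes E: "orthonormal_basis E" and A: "bounded_clinear A"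
  shows "bounded_clinear (cadjoint A)"
proof -
  note adj = cinner_cadjoint[OF E A, symmetric]
  obtain K where K: "K > 0" "\<And>x. norm (A x) \<le> K * norm x"
    using bounded_clinear_bound[OF A] by blast
  have add: "cadjoint A (x + y) = cadjoint A x + cadjoint A y" for x y
    by (rule cinner_ext) (simp add: adj cinner_add_right)
  have scale: "cadjoint A (c *\<^sub>C x) = c *\<^sub>C cadjoint A x" for c x
    by (rule cinner_ext) (simp add: adj cinner_scaleC_right)
  have "norm (cadjoint A x) \<le> norm x * K" for x
  proof -
    have "(norm (cadjoint A x))\<^sup>2 = cmod (cinner (cadjoint A x) (cadjoint A x))"
      by (simp add: cinner_self norm_power)
    also have "\<dots> \<le> norm (A (cadjoint A x)) * norm x"
      unfolding adj by (rule norm_cinner_le)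
    also have "\<dots> \<le> K * norm (cadjoint A x) * norm x"
      by (intro mult_right_mono K) auto
    finally show ?thesis
      using K(1) by (cases "cadjoint A x = 0") (auto simp: power2_eq_square algebra_simps)
  qed
  then have "bounded_linear (cadjoint A)"
    by (intro bounded_linear_intro[where K = K]) (simp_all add: add scaleR_scaleC scale)
  then show ?thesis
    by (simp add: bounded_clinear_def scale)
qed

lemma cinner_cadjoint_left:
  fixes A :: "'a::complex_hilbert \<Rightarrow> 'a" and E :: "'a set"
  assumes "orthonormal_basis E" "bounded_clinear A"
  shows "cinner (cadjoint A x) y = cinner x (A y)"
proof -
  have "cinner (cadjoint A x) y = cnj (cinner y (cadjoint A x))"
    by (rule cinner_commute)
  also have "\<dots> = cinner x (A y)"
    by (simp only: cinner_cadjoint[OF assms, symmetric] cinner_commute[symmetric])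
  finally show ?thesis .
qed

lemma cadjoint_cadjoint:
  fixes A :: "'a::complex_hilbert \<Rightarrow> 'a" and E :: "'a set"
  assumes "orthonormal_basis E" "bounded_clinear A"
  shows "cadjoint (cadjoint A) = A"
  by (rule cadjoint_eqI) (rule cinner_cadjoint_left[OF assms])

subsection \<open>Square roots of positive operators\<close>

text \<open>The Taylor coefficients of \<open>sqrt (1 - x)\<close> at \<open>0\<close>.\<close>

definition sqrt_coeff :: "nat \<Rightarrow> real" where
  "sqrt_coeff n = (1 / 2 gchoose n) * (- 1) ^ n"

lemma sqrt_coeff_0 [simp]: "sqrt_coeff 0 = 1"
  by (simp add: sqrt_coeff_def)

text \<open>The partial sums are the coefficients of sqrt(1 - x) / (1 - x) = (1 - x)^(-1/2), which
  are quotients of rising factorials of 1/2 by factorials.\<close>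

lemma sum_sqrt_coeff_nonneg: "0 \<le> (\<Sum>k\<le>m. sqrt_coeff k)"
proof -
  have "(\<Sum>k\<le>m. sqrt_coeff k) = (- 1) ^ m * (- (1 / 2) gchoose m)"
    unfolding sqrt_coeff_def gbinomial_sum_lower_neg by simp
  also have "\<dots> = pochhammer (1 / 2) m / fact m"
    by (simp add: gbinomial_pochhammer power_mult_distrib[symmetric] flip: mult.assoc)
  also have "\<dots> \<ge> 0"
    by (intro divide_nonneg_nonneg pochhammer_nonneg) auto
  finally show ?thesis .
qed

text \<open>The derivative of sqrt(1 - x) is -1/2 times (1 - x)^(-1/2), a series with nonnegative
  coefficients. The absorption identity states this coefficientwise.\<close>

lemma sqrt_coeff_nonpos:
  assumes "n > 0"
  shows "sqrt_coeff n \<le> 0"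
proof -
  obtain m where m: "n = Suc m"
    using assms gr0_implies_Suc by blast
  have "real (Suc m) * (1 / 2 gchoose Suc m) = 1 / 2 * (- (1 / 2) gchoose m)"
    using gbinomial_absorption[of m "1 / 2 :: real"] by simp
  then have "real (Suc m) * sqrt_coeff n = - (1 / 2) * ((- 1) ^ m * (- (1 / 2) gchoose m))"
    by (simp add: sqrt_coeff_def m del: of_nat_Suc)
  also have "(- 1) ^ m * (- (1 / 2) gchoose m) = pochhammer (1 / 2 :: real) m / fact m"
    by (simp add: gbinomial_pochhammer power_mult_distrib[symmetric] flip: mult.assoc)
  also have "- (1 / 2) * \<dots> \<le> 0"
    using pochhammer_nonneg[of "1 / 2 :: real" m] by simp
  finally show ?thesis
    by (simp add: mult_le_0_iff)
qed

text \<open>Only the coefficient at 0, which is 1, is positive. The sum of the absolute values is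
  therefore 2 minus a partial sum, hence at most 2.\<close>

lemma abs_summable_sqrt_coeff: "(\<lambda>n. \<bar>sqrt_coeff n\<bar>) summable_on UNIV"
proof -
  have "(\<Sum>k<n. \<bar>sqrt_coeff k\<bar>) \<le> 2" for n
  proof (cases n)
    case (Suc m)
    have "(\<Sum>k<n. \<bar>sqrt_coeff k\<bar>) = (\<Sum>k\<le>m. (if k = 0 then 2 else 0) - sqrt_coeff k)"
      unfolding Suc lessThan_Suc_atMost
      by (intro sum.cong) (auto simp: sqrt_coeff_nonpos)
    also have "\<dots> \<le> 2"
      using sum_sqrt_coeff_nonneg[of m] by (simp add: sum_subtractf)
    finally show ?thesis .
  qed simp
  then have "summable (\<lambda>n. \<bar>sqrt_coeff n\<bar>)"
    by (intro summableI_nonneg_bounded) auto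
  then show ?thesis
    by (intro summable_nonneg_imp_summable_on) auto
qed

text \<open>The square of sqrt(1 - x) is 1 - x; on coefficients this is the Vandermonde identity for
  1/2 + 1/2 = 1.\<close>

lemma sqrt_coeff_convolution:
  "(\<Sum>k\<le>n. sqrt_coeff k * sqrt_coeff (n - k)) = (if n = 0 then 1 else if n = 1 then - 1 else 0)"
proof -
  have "(\<Sum>k\<le>n. sqrt_coeff k * sqrt_coeff (n - k))
      = (\<Sum>k\<le>n. (1 / 2 gchoose k) * (1 / 2 gchoose (n - k)) * (- 1) ^ n)"
    by (intro sum.cong) (auto simp: sqrt_coeff_def power_add[symmetric])
  also have "\<dots> = real (1 choose n) * (- 1) ^ n"
    using gbinomial_Vandermonde[of "1 / 2 :: real" "1 / 2" n]
    by (simp add: sum_distrib_right[symmetric] atLeast0AtMost binomial_gbinomial)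
  also have "\<dots> = (if n = 0 then 1 else if n = 1 then - 1 else 0)"
    by (auto simp: binomial_eq_0)
  finally show ?thesis .
qed

section \<open>Square roots of \<open>I - X\<close> for symmetric contractions \<open>X\<close>,
  then of positive operators\<close>

lemma symmetric_funpow:
  assumes "\<And>x y. cinner (X x) y = cinner x (X y)"
  shows "cinner ((X ^^ n) x) y = cinner x ((X ^^ n) y)"
  by (induction n arbitrary: x y) (simp_all add: assms funpow_swap1)

lemma bounded_clinear_funpow: "bounded_clinear X \<Longrightarrow> bounded_clinear (X ^^ n)"
proof (induction n)
  case 0
  then show ?case
    by (simp add: bounded_clinear_def id_def bounded_linear_ident)
next
  case (Suc n)
  then show ?case
    using bounded_clinear_compose[of X "X ^^ n"] by (simp add: o_def)
qed

text \<open>The root is the binomial series of sqrt(1 - x) evaluated at \<open>X\<close>. Since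
  powers of \<open>X\<close> are contractions, absolute summability of the coefficients dominates
  every series involved.\<close>

lemma sqrt_one_minus_contraction:
  fixes X :: "'a::complex_hilbert \<Rightarrow> 'a"
  assumes X: "bounded_clinear X" and sym: "\<And>x y. cinner (X x) y = cinner x (X y)"
    and contr: "\<And>x. norm (X x) \<le> norm x"
  obtains S where "bounded_clinear S" "\<And>x y. cinner (S x) y = cinner x (S y)"
    "\<And>x. 0 \<le> Re (cinner (S x) x)" "\<And>x. S (S x) = x - X x"
proof -
  let ?c = sqrt_coeff
  have norm_pow: "norm ((X ^^ n) x) \<le> norm x" for n x
    by (induction n) (use contr order_trans in \<open>auto simp del: funpow.simps(1)\<close>)
  note pow = bounded_clinear_funpow[OF X]
  define S where "S x = (\<Sum>\<^sub>\<infinity>n. ?c n *\<^sub>R (X ^^ n) x)" for x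
  define K where "K = (\<Sum>\<^sub>\<infinity>n. \<bar>?c n\<bar>)"
  have K: "((\<lambda>n. \<bar>?c n\<bar>) has_sum K) UNIV"
    using abs_summable_sqrt_coeff by (simp add: K_def)
  have abs: "(\<lambda>n. norm (?c n *\<^sub>R (X ^^ n) x)) summable_on UNIV" for x
  proof (rule Infinite_Sum.abs_summable_on_comparison_test')
    show "(\<lambda>n. \<bar>?c n\<bar> * norm x) summable_on UNIV"
      using K has_sum_imp_summable summable_on_cmult_left by blast
  qed (simp add: mult_left_mono norm_pow)
  have S: "((\<lambda>n. ?c n *\<^sub>R (X ^^ n) x) has_sum S x) UNIV" for x
    unfolding S_def using Infinite_Sum.abs_summable_summable[OF abs] by simp
  \<comment> \<open>Bounded linear maps pass through the series. This serves for scalar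
    multiplication, for both arguments of \<open>cinner\<close>, and for the powers of
    \<open>X\<close>.\<close>
  have S_bl: "((\<lambda>n. ?c n *\<^sub>R h ((X ^^ n) x)) has_sum h (S x)) UNIV"
    if "bounded_linear h" for h :: "'a \<Rightarrow> 'b::real_normed_vector" and x
    using has_sum_bounded_linear[OF that S] by (simp add: linear_simps[OF that])
  have "S (x + y) = S x + S y" for x y
  proof (rule has_sum_unique[OF S])
    show "((\<lambda>n. ?c n *\<^sub>R (X ^^ n) (x + y)) has_sum S x + S y) UNIV"
      using has_sum_add[OF S S, of x y]
      by (simp add: linear_simps[OF bounded_clinearD(1)[OF pow]] scaleR_add_right)
  qed
  moreover have S_scale: "S (c *\<^sub>C x) = c *\<^sub>C S x" for c x
  proof (rule has_sum_unique[OF S])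
    show "((\<lambda>n. ?c n *\<^sub>R (X ^^ n) (c *\<^sub>C x)) has_sum c *\<^sub>C S x) UNIV"
      using S_bl[OF bounded_linear_scaleC] by (simp add: bounded_clinearD[OF pow])
  qed
  moreover have "norm (S x) \<le> norm x * K" for x
  proof -
    have "norm (S x) \<le> (\<Sum>\<^sub>\<infinity>n. norm (?c n *\<^sub>R (X ^^ n) x))"
      using norm_has_sum_bound[OF _ S] abs by (simp add: has_sum_infsum)
    also have "\<dots> \<le> (\<Sum>\<^sub>\<infinity>n. \<bar>?c n\<bar> * norm x)"
    proof (rule infsum_mono[OF abs])
      show "(\<lambda>n. \<bar>?c n\<bar> * norm x) summable_on UNIV"
        using K has_sum_imp_summable summable_on_cmult_left by blast
    qed (simp add: mult_left_mono norm_pow)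
    also have "\<dots> = norm x * K"
      using has_sum_cmult_left[OF K, of "norm x"] by (simp add: infsumI mult.commute)
    finally show ?thesis .
  qed
  ultimately have S_bcl: "bounded_clinear S"
    unfolding bounded_clinear_def
    by (intro conjI allI bounded_linear_intro[where K = K]) (simp_all add: scaleR_scaleC)
  have S_sym: "cinner (S x) y = cinner x (S y)" for x y
  proof (rule has_sum_unique)
    show "((\<lambda>n. ?c n *\<^sub>R cinner ((X ^^ n) x) y) has_sum cinner (S x) y) UNIV"
      by (rule S_bl[OF bounded_linear_cinner_left])
    show "((\<lambda>n. ?c n *\<^sub>R cinner ((X ^^ n) x) y) has_sum cinner x (S y)) UNIV"
      unfolding symmetric_funpow[OF sym] by (rule S_bl[OF bounded_linear_cinner_right])
  qed
  have S_nonneg: "0 \<le> Re (cinner (S x) x)" for x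
  proof -
    have "((\<lambda>n. ?c n * Re (cinner ((X ^^ n) x) x)) has_sum Re (cinner (S x) x)) UNIV"
      using has_sum_Re[OF S_bl[OF bounded_linear_cinner_left]] by simp
    then have "(\<lambda>m. \<Sum>n\<le>m. ?c n * Re (cinner ((X ^^ n) x) x)) \<longlonglongrightarrow> Re (cinner (S x) x)"
      using has_sum_imp_sums sums_def_le by blast
    \<comment> \<open>For n > 0 the coefficient is nonpositive and the inner product is at most the
      squared norm of \<open>x\<close>, while at n = 0 both are equal. So the partial sum is at
      least the partial sum of coefficients times that squared norm.\<close>
    moreover have "0 \<le> (\<Sum>n\<le>m. ?c n * Re (cinner ((X ^^ n) x) x))" for m
    proof -
      have "0 \<le> (\<Sum>n\<le>m. ?c n) * (norm x)\<^sup>2"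
        using sum_sqrt_coeff_nonneg by simp
      also have "\<dots> = (\<Sum>n\<le>m. ?c n * (norm x)\<^sup>2)"
        by (rule sum_distrib_right)
      also have "\<dots> \<le> (\<Sum>n\<le>m. ?c n * Re (cinner ((X ^^ n) x) x))"
      proof (rule sum_mono)
        fix n
        have "Re (cinner ((X ^^ n) x) x) \<le> norm ((X ^^ n) x) * norm x"
          using complex_Re_le_cmod norm_cinner_le order_trans by blast
        also have "\<dots> \<le> (norm x)\<^sup>2"
          by (simp add: power2_eq_square mult_right_mono norm_pow)
        finally show "?c n * (norm x)\<^sup>2 \<le> ?c n * Re (cinner ((X ^^ n) x) x)"
          by (cases "n = 0") (auto simp: cinner_self sqrt_coeff_nonpos intro: mult_left_mono_neg)
      qed
      finally show ?thesis .
    qed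
    ultimately show ?thesis
      by (intro LIMSEQ_le_const) auto
  qed
  have "S (S x) = x - X x" for x
  proof -
    \<comment> \<open>Cauchy product: \<open>g\<close> is absolutely summable over pairs. Summing
      row by row gives \<open>S (S x)\<close>, and summing along the antidiagonals gives
      \<open>x - X x\<close>.\<close>
    define g where "g = (\<lambda>(m, n). (?c m * ?c n) *\<^sub>R (X ^^ (m + n)) x)"
    have "(\<lambda>(m, n). \<bar>?c m\<bar> * \<bar>?c n\<bar> * norm x) summable_on UNIV \<times> UNIV"
    proof (rule summable_on_SigmaI)
      show "((\<lambda>n. case (m, n) of (m, n) \<Rightarrow> \<bar>?c m\<bar> * \<bar>?c n\<bar> * norm x) has_sum \<bar>?c m\<bar> * K * norm x) UNIV" for m
        using has_sum_cmult_left[OF has_sum_cmult_right[OF K]] by simp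
      show "(\<lambda>m. \<bar>?c m\<bar> * K * norm x) summable_on UNIV"
        using K by (intro summable_on_cmult_left) (auto simp: summable_on_def)
    qed auto
    then have "(\<lambda>p. norm (g p)) summable_on UNIV \<times> UNIV"
      by (rule Infinite_Sum.abs_summable_on_comparison_test')
        (auto simp: g_def abs_mult mult_left_mono norm_pow)
    then obtain s where s: "(g has_sum s) (UNIV \<times> UNIV)"
      using Infinite_Sum.abs_summable_summable by (auto simp: summable_on_def)
    have "((\<lambda>m. ?c m *\<^sub>R (X ^^ m) (S x)) has_sum s) UNIV"
    proof (rule has_sum_SigmaD[OF s])
      show "((\<lambda>n. g (m, n)) has_sum ?c m *\<^sub>R (X ^^ m) (S x)) UNIV" for m
        using has_sum_bounded_linear[OF bounded_linear_scaleR_right S_bl[OF bounded_clinearD(1)[OF pow]]]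
        by (simp add: g_def funpow_add)
    qed
    then have 1: "s = S (S x)"
      using S has_sum_unique by blast
    have bij: "bij_betw (\<lambda>(k, i). (i, k - i)) (SIGMA k:UNIV. {..k::nat}) (UNIV \<times> UNIV)"
      by (rule bij_betw_byWitness[where f' = "\<lambda>(m, n). (m + n, m)"]) auto
    have "((\<lambda>p. g (case p of (k, i) \<Rightarrow> (i, k - i))) has_sum s) (SIGMA k:UNIV. {..k})"
      unfolding has_sum_reindex_bij_betw[OF bij] by (rule s)
    then have "((\<lambda>k::nat. if k = 0 then x else if k = 1 then - X x else 0) has_sum s) UNIV"
    proof (rule has_sum_SigmaD)
      have "(\<Sum>i\<le>k. g (i, k - i)) = (if k = 0 then x else if k = 1 then - X x else 0)" for k
      proof -
        have "(\<Sum>i\<le>k. g (i, k - i)) = (\<Sum>i\<le>k. ?c i * ?c (k - i)) *\<^sub>R (X ^^ k) x"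
          by (simp add: g_def scaleR_sum_left)
        then show ?thesis
          by (simp add: sqrt_coeff_convolution)
      qed
      then show "((\<lambda>i. g (case (k, i) of (k, i) \<Rightarrow> (i, k - i))) has_sum
          (if k = 0 then x else if k = 1 then - X x else 0)) {..k}" for k
        by (intro has_sum_finiteI) auto
    qed
    moreover have "((\<lambda>k. if k = 0 then x else if k = 1 then - X x else 0) has_sum x - X x) (UNIV::nat set)"
      by (rule has_sum_finite_neutralI[of "{0, 1}"]) auto
    ultimately show ?thesis
      using 1 has_sum_unique by blast
  qed
  then show ?thesis
    using that S_bcl S_sym S_nonneg by blast
qed

text \<open>Dividing by a bound \<open>K\<close> of \<open>T\<close> makes X = I - T/K a symmetric
  contraction. A root of I - X = T/K, multiplied by \<open>sqrt K\<close>, is a root of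
  \<open>T\<close>.\<close>

lemma positive_sqrt_exists:
  fixes T :: "'a::complex_hilbert \<Rightarrow> 'a"
  assumes T: "bounded_clinear T" and sym: "\<And>x y. cinner (T x) y = cinner x (T y)"
    and pos: "\<And>x. 0 \<le> Re (cinner (T x) x)"
  shows "\<exists>S. positive_op S \<and> S \<circ> S = T"
proof -
  obtain K where K: "K > 0" "\<And>x. norm (T x) \<le> K * norm x"
    using bounded_clinear_bound[OF T] by blast
  note lin = linear_simps[OF bounded_clinearD(1)[OF T]]
  define X where "X x = x - (1 / K) *\<^sub>R T x" for x
  have "bounded_clinear X"
    using bounded_clinear_lincomb[of id T 1 "- 1 / K"] T
    by (simp add: X_def[abs_def] bounded_clinear_def id_def bounded_linear_ident scaleR_scaleC)
  moreover have X_sym: "cinner (X x) y = cinner x (X y)" for x y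
    by (simp add: X_def cinner_diff_left cinner_diff_right cinner_scaleR_left cinner_scaleR_right sym)
  moreover have "norm (X x) \<le> norm x" for x
  proof -
    \<comment> \<open>Positivity at \<open>X x\<close> gives \<open>\<parallel>T x\<parallel>\<^sup>2 \<le> K \<langle>T x, x\<rangle>\<close>.\<close>
    let ?t = "Re (cinner (T x) x)"
    have "Re (cinner (T (X x)) (X x)) = ?t - 2 / K * (norm (T x))\<^sup>2 + (1 / K)\<^sup>2 * Re (cinner (T (T x)) (T x))"
      by (simp add: X_def lin cinner_diff_left cinner_diff_right cinner_scaleR_left
          cinner_scaleR_right sym[of "T x" x] cinner_self power2_eq_square algebra_simps)
    moreover have "Re (cinner (T (T x)) (T x)) \<le> K * (norm (T x))\<^sup>2"
    proof -
      have "Re (cinner (T (T x)) (T x)) \<le> norm (T (T x)) * norm (T x)"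
        using complex_Re_le_cmod norm_cinner_le order_trans by blast
      also have "\<dots> \<le> K * norm (T x) * norm (T x)"
        by (intro mult_right_mono K) auto
      finally show ?thesis by (simp add: power2_eq_square)
    qed
    then have "(1 / K)\<^sup>2 * Re (cinner (T (T x)) (T x)) \<le> (1 / K)\<^sup>2 * (K * (norm (T x))\<^sup>2)"
      by (rule mult_left_mono) simp
    then have "(1 / K)\<^sup>2 * Re (cinner (T (T x)) (T x)) \<le> 1 / K * (norm (T x))\<^sup>2"
      using K(1) by (simp add: power2_eq_square)
    ultimately have "1 / K * (norm (T x))\<^sup>2 \<le> ?t"
      using pos[of "X x"] by simp
    then have "1 / K * (1 / K * (norm (T x))\<^sup>2) \<le> 1 / K * ?t"
      using K(1) by (intro mult_left_mono) auto
    \<comment> \<open>By the preceding inequality the last summand is at most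
      \<open>1 / K * ?t\<close>, which cancels only half of the negative term.\<close>
    moreover have "(norm (X x))\<^sup>2 = (norm x)\<^sup>2 - 2 * (1 / K * ?t) + 1 / K * (1 / K * (norm (T x))\<^sup>2)"
      unfolding X_def power2_norm_eq_inner inner_eq_Re_cinner[of "T x" x, symmetric]
      by (simp add: inner_diff_left inner_diff_right inner_commute[of x "T x"]
          diff_divide_distrib)
    moreover have "0 \<le> 1 / K * ?t"
      using K pos by simp
    ultimately have "(norm (X x))\<^sup>2 \<le> (norm x)\<^sup>2"
      by linarith
    then show ?thesis
      by (simp add: power2_le_iff_abs_le)
  qed
  ultimately obtain S where S: "bounded_clinear S" "\<And>x y. cinner (S x) y = cinner x (S y)"
    "\<And>x. 0 \<le> Re (cinner (S x) x)" "\<And>x. S (S x) = x - X x"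
    using sqrt_one_minus_contraction by metis
  define R where "R x = sqrt K *\<^sub>R S x" for x
  have "R (R x) = T x" for x
    using K(1) by (simp add: R_def linear_simps[OF bounded_clinearD(1)[OF S(1)]] S X_def
        scaleR_diff_right)
  moreover have "positive_op R"
    unfolding positive_op_def
  proof (intro conjI allI)
    show "bounded_clinear R"
      using bounded_clinear_lincomb[OF S(1) S(1), of "sqrt K" 0]
      by (simp add: R_def[abs_def] scaleR_scaleC)
    show "cadjoint R = R"
      by (rule cadjoint_eqI) (simp add: R_def cinner_scaleR_left cinner_scaleR_right S)
    show "0 \<le> Re (cinner (R x) x)" for x
      using K(1) S(3) by (simp add: R_def cinner_scaleR_left)
  qed
  ultimately show ?thesis
    by (auto simp: o_def)
qed

text \<open>Once a positive root exists, whichever one \<open>sqrt_op\<close> selects squares to the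
  given operator.\<close>

lemma modulus_square:
  fixes A :: "'a::complex_hilbert \<Rightarrow> 'a" and E :: "'a set"
  assumes E: "orthonormal_basis E" and A: "bounded_clinear A"
  shows "modulus A ^^ 2 = cadjoint A \<circ> A"
proof -
  have sym: "cinner ((cadjoint A \<circ> A) x) y = cinner (A x) (A y)" for x y
    by (simp add: cinner_cadjoint_left[OF E A])
  have "\<exists>S. positive_op S \<and> S \<circ> S = cadjoint A \<circ> A"
  proof (rule positive_sqrt_exists)
    show "bounded_clinear (cadjoint A \<circ> A)"
      by (intro bounded_clinear_compose bounded_clinear_cadjoint[OF E] A)
    show "cinner ((cadjoint A \<circ> A) x) y = cinner x ((cadjoint A \<circ> A) y)" for x y
      unfolding sym by (simp add: cinner_cadjoint[OF E A])
    show "0 \<le> Re (cinner ((cadjoint A \<circ> A) x) x)" for x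
      unfolding sym by (simp add: cinner_self)
  qed
  from someI_ex[OF this] show ?thesis
    by (simp add: modulus_def sqrt_op_def numeral_2_eq_2)
qed

subsection \<open>Hilbert-Schmidt operators and traces\<close>

text \<open>By Parseval in \<open>F\<close> and in \<open>E\<close>, both sums of squared norms
  equal the double sum of the squared moduli of \<open>cinner (A e) f\<close>, taken in the two
  possible orders.\<close>

lemma summable_norm_cadjoint:
  fixes A :: "'a::complex_hilbert \<Rightarrow> 'a" and E F :: "'a set"
  assumes E: "orthonormal_basis E" and F: "orthonormal_basis F" and A: "bounded_clinear A"
    and hs: "(\<lambda>e. (norm (A e))\<^sup>2) summable_on E"
  shows "(\<lambda>f. (norm (cadjoint A f))\<^sup>2) summable_on F"
proof -
  have "(\<lambda>(e, f). (cmod (cinner (A e) f))\<^sup>2) summable_on E \<times> F"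
    by (rule summable_on_SigmaI[where g = "\<lambda>e. (norm (A e))\<^sup>2"]) (auto simp: parseval_norm[OF F] hs)
  then obtain s where "((\<lambda>(e, f). (cmod (cinner (A e) f))\<^sup>2) has_sum s) (E \<times> F)"
    by (auto simp: summable_on_def)
  then have "((\<lambda>(f, e). (cmod (cinner (A e) f))\<^sup>2) has_sum s) (F \<times> E)"
    by (subst (asm) has_sum_swap) (simp add: case_prod_unfold)
  then have "((\<lambda>f. (norm (cadjoint A f))\<^sup>2) has_sum s) F"
  proof (rule has_sum_SigmaD)
    fix f
    have "cmod (cinner (cadjoint A f) e) = cmod (cinner (A e) f)" for e
      by (simp add: cinner_cadjoint_left[OF E A] norm_cinner_commute[of f])
    then show "((\<lambda>e. case (f, e) of (f, e) \<Rightarrow> (cmod (cinner (A e) f))\<^sup>2) has_sum (norm (cadjoint A f))\<^sup>2) E"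
      using parseval_norm[OF E, of "cadjoint A f"] by simp
  qed
  then show ?thesis
    by (rule has_sum_imp_summable)
qed

text \<open>Change of basis by taking adjoints twice: from \<open>A\<close> on \<open>F\<close> to
  the adjoint on \<open>F\<close>, then to the adjoint of the adjoint, which is \<open>A\<close>, on
  \<open>E\<close>.\<close>

lemma hilbert_schmidt_iff:
  fixes A :: "'a::complex_hilbert \<Rightarrow> 'a" and E :: "'a set"
  assumes E: "orthonormal_basis E"
  shows "A \<in> hilbert_schmidt \<longleftrightarrow> bounded_clinear A \<and> (\<lambda>e. (norm (A e))\<^sup>2) summable_on E"
proof
  assume "A \<in> hilbert_schmidt"
  then obtain F where A: "bounded_clinear A" and F: "orthonormal_basis F"
    and hs: "(\<lambda>e. (norm (A e))\<^sup>2) summable_on F"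
    by (auto simp: hilbert_schmidt_def)
  show "bounded_clinear A \<and> (\<lambda>e. (norm (A e))\<^sup>2) summable_on E"
    using A summable_norm_cadjoint[OF F E bounded_clinear_cadjoint[OF F A] summable_norm_cadjoint[OF F F A hs]]
    by (simp add: cadjoint_cadjoint[OF F A])
qed (use E in \<open>auto simp: hilbert_schmidt_def\<close>)

text \<open>Both series are iterated sums of \<open>h\<close>. Summing over \<open>e\<close> first
  uses Parseval; summing over \<open>f\<close> first uses the expansion of
  \<open>cadjoint B e\<close>, whose coefficients are \<open>cinner e (B f)\<close>. The interchange
  is justified by the majorant |ab| <= |a|^2 + |b|^2.\<close>

lemma has_sum_comp_cadjoint:
  fixes X B :: "'a::complex_hilbert \<Rightarrow> 'a" and E :: "'a set"
  assumes E: "orthonormal_basis E" and X: "bounded_clinear X" and B: "bounded_clinear B"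
    and hs: "(\<lambda>e. (norm (X e))\<^sup>2) summable_on E" "(\<lambda>e. (norm (B e))\<^sup>2) summable_on E"
  shows "\<exists>s. ((\<lambda>f. cinner (X f) (B f)) has_sum s) E \<and> ((\<lambda>e. cinner (X (cadjoint B e)) e) has_sum s) E"
proof -
  define h where "h = (\<lambda>(f, e). cinner (X f) e * cinner e (B f))"
  have "(\<lambda>(f, e). (cmod (cinner (X f) e))\<^sup>2 + (cmod (cinner (B f) e))\<^sup>2) summable_on E \<times> E"
  proof (rule summable_on_SigmaI)
    show "((\<lambda>e. case (f, e) of (f, e) \<Rightarrow> (cmod (cinner (X f) e))\<^sup>2 + (cmod (cinner (B f) e))\<^sup>2)
        has_sum (norm (X f))\<^sup>2 + (norm (B f))\<^sup>2) E" for f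
      unfolding prod.case by (intro has_sum_add parseval_norm[OF E])
    show "(\<lambda>f. (norm (X f))\<^sup>2 + (norm (B f))\<^sup>2) summable_on E"
      using hs by (rule summable_on_add)
  qed auto
  then have "(\<lambda>p. norm (h p)) summable_on E \<times> E"
  proof (rule Infinite_Sum.abs_summable_on_comparison_test')
    fix p :: "'a \<times> 'a"
    obtain f e where p: "p = (f, e)" by (cases p)
    have "norm (h p) = cmod (cinner (X f) e) * cmod (cinner (B f) e)"
      by (simp add: p h_def norm_mult norm_cinner_commute[of e "B f"])
    also have "\<dots> \<le> (cmod (cinner (X f) e))\<^sup>2 + (cmod (cinner (B f) e))\<^sup>2"
      using sum_squares_bound[of "cmod (cinner (X f) e)" "cmod (cinner (B f) e)"]
        mult_nonneg_nonneg[OF norm_ge_zero[of "cinner (X f) e"] norm_ge_zero[of "cinner (B f) e"]]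
      by linarith
    finally show "norm (h p) \<le> (case p of (f, e) \<Rightarrow> (cmod (cinner (X f) e))\<^sup>2 + (cmod (cinner (B f) e))\<^sup>2)"
      by (simp add: p)
  qed
  then have "h summable_on E \<times> E"
    by (rule Infinite_Sum.abs_summable_summable)
  then obtain s where s: "(h has_sum s) (E \<times> E)"
    by (auto simp: summable_on_def)
  have "((\<lambda>f. cinner (X f) (B f)) has_sum s) E"
    by (rule has_sum_SigmaD[OF s]) (simp add: h_def parseval_cinner[OF E])
  moreover have "((\<lambda>e. cinner (X (cadjoint B e)) e) has_sum s) E"
  proof (rule has_sum_SigmaD)
    show "((\<lambda>(e, f). h (f, e)) has_sum s) (E \<times> E)"
      using s by (subst (asm) has_sum_swap)
    fix e
    show "((\<lambda>f. case (e, f) of (e, f) \<Rightarrow> h (f, e)) has_sum cinner (X (cadjoint B e)) e) E"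
      using has_sum_bounded_linear[OF bounded_linear_compose[OF bounded_linear_cinner_left
            bounded_clinearD(1)[OF X]] orthonormal_basis_expansion[OF E], of "cadjoint B e" e]
      by (simp add: h_def bounded_clinearD[OF X] cinner_scaleC_left cinner_cadjoint_left[OF E B] mult.commute)
  qed
  ultimately show ?thesis by blast
qed

subsection \<open>Semi-inner products\<close>

text \<open>The vectors are functions in a set \<open>V\<close>, so that the Hilbert-Schmidt
  operators fit without a type of their own. \<open>F A A\<close> may vanish for nonzero
  \<open>A\<close>, as happens when \<open>P\<close> has a kernel.\<close>

locale semi_inner_form =
  fixes V :: "('b \<Rightarrow> 'a::complex_inner) set" and F :: "('b \<Rightarrow> 'a) \<Rightarrow> ('b \<Rightarrow> 'a) \<Rightarrow> complex"
  assumes lincomb: "A \<in> V \<Longrightarrow> B \<in> V \<Longrightarrow> (\<lambda>x. a *\<^sub>C A x + b *\<^sub>C B x) \<in> V"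
    and left: "A \<in> V \<Longrightarrow> B \<in> V \<Longrightarrow> C \<in> V \<Longrightarrow>
      F (\<lambda>x. a *\<^sub>C A x + b *\<^sub>C B x) C = a * F A C + b * F B C"
    and commute: "A \<in> V \<Longrightarrow> B \<in> V \<Longrightarrow> F A B = cnj (F B A)"
    and nonneg: "A \<in> V \<Longrightarrow> 0 \<le> Re (F A A)"
begin

lemma right:
  assumes "A \<in> V" "B \<in> V" "C \<in> V"
  shows "F C (\<lambda>x. a *\<^sub>C A x + b *\<^sub>C B x) = cnj a * F C A + cnj b * F C B"
  using assms
  by (simp add: commute[of C "\<lambda>x. a *\<^sub>C A x + b *\<^sub>C B x"] commute[of C A] commute[of C B] left lincomb)

lemma lincomb_lincomb:
  assumes "A \<in> V" "B \<in> V" "A' \<in> V" "B' \<in> V"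
  shows "F (\<lambda>x. a *\<^sub>C A x + b *\<^sub>C B x) (\<lambda>x. a' *\<^sub>C A' x + b' *\<^sub>C B' x)
    = a * cnj a' * F A A' + a * cnj b' * F A B' + b * cnj a' * F B A' + b * cnj b' * F B B'"
  using assms by (simp add: left right lincomb algebra_simps)

lemma self:
  assumes "A \<in> V"
  shows "F A A = of_real (Re (F A A))"
  using arg_cong[OF commute[OF assms assms], of Im] by (simp add: complex_eq_iff)

lemma cmod_commute:
  assumes "A \<in> V" "B \<in> V"
  shows "cmod (F A B) = cmod (F B A)"
  by (subst commute) (use assms in auto)

lemma cauchy_schwarz:
  assumes A: "A \<in> V" and B: "B \<in> V"
  shows "(cmod (F A B))\<^sup>2 \<le> Re (F A A) * Re (F B B)"
proof -
  let ?a = "Re (F A A)" and ?b = "Re (F B B)" and ?q = "(cmod (F A B))\<^sup>2"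
  have quad: "0 \<le> s\<^sup>2 * ?a - 2 * s * r * ?q + r\<^sup>2 * ?q * ?b" for s r
  proof -
    \<comment> \<open>The factor \<open>F A B\<close> in the second coefficient makes the cross
      terms real. Two free parameters \<open>s\<close> and \<open>r\<close> cover the degenerate
      case as well.\<close>
    define C where "C = (\<lambda>x. complex_of_real s *\<^sub>C A x + (- of_real r * F A B) *\<^sub>C B x)"
    have "F C C = of_real (s\<^sup>2) * F A A - 2 * of_real (s * r) * (F A B * cnj (F A B))
        + of_real (r\<^sup>2) * (F A B * cnj (F A B)) * F B B"
      unfolding C_def lincomb_lincomb[OF A B A B]
      by (simp add: commute[OF B A] power2_eq_square algebra_simps)
    also have "\<dots> = of_real (s\<^sup>2) * of_real ?a - 2 * of_real (s * r) * of_real ?q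
        + of_real (r\<^sup>2) * of_real ?q * of_real ?b"
      using self[OF A] self[OF B] complex_norm_square[of "F A B"] by simp
    also have "\<dots> = of_real (s\<^sup>2 * ?a - 2 * s * r * ?q + r\<^sup>2 * ?q * ?b)"
      by simp
    finally have "Re (F C C) = s\<^sup>2 * ?a - 2 * s * r * ?q + r\<^sup>2 * ?q * ?b"
      by simp
    moreover have "C \<in> V"
      unfolding C_def by (rule lincomb[OF A B])
    ultimately show ?thesis
      using nonneg[of C] by simp
  qed
  show ?thesis
  proof (cases "?b = 0")
    case True
    have "?q = 0"
    proof (rule ccontr)
      assume "?q \<noteq> 0"
      then show False
        \<comment> \<open>With ?b = 0 this choice of \<open>r\<close> turns the quadratic into -?a -
          2, which is negative.\<close>
        using quad[of 1 "(?a + 1) / ?q"] nonneg[OF A] True by simp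
    qed
    then show ?thesis
      using True by simp
  next
    case False
    then have "?b > 0"
      using nonneg[OF B] by simp
    moreover have "0 \<le> ?b * (?a * ?b - ?q)"
      using quad[of ?b 1] by (simp add: power2_eq_square algebra_simps)
    ultimately show ?thesis
      by (simp add: zero_le_mult_iff)
  qed
qed

lemma cmod_le:
  assumes "A \<in> V" "B \<in> V"
  shows "cmod (F A B) \<le> sqrt (Re (F A A)) * sqrt (Re (F B B))"
  using real_le_rsqrt[OF cauchy_schwarz[OF assms]] by (simp add: real_sqrt_mult)

lemma triangle:
  assumes A: "A \<in> V" and B: "B \<in> V"
  shows "sqrt (Re (F A A) + 2 * Re (F A B) + Re (F B B)) \<le> sqrt (Re (F A A)) + sqrt (Re (F B B))"
proof (rule real_le_lsqrt)
  have "Re (F A B) \<le> sqrt (Re (F A A)) * sqrt (Re (F B B))"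
    using complex_Re_le_cmod cmod_le[OF assms] order_trans by blast
  then show "Re (F A A) + 2 * Re (F A B) + Re (F B B) \<le> (sqrt (Re (F A A)) + sqrt (Re (F B B)))\<^sup>2"
    using nonneg A B by (simp add: power2_sum)
qed (use nonneg A B in auto)

text \<open>Cauchy-Schwarz for the components of \<open>A\<close> and \<open>B\<close> orthogonal to \<open>C\<close>, scaled by \<open>F C C\<close>.\<close>

lemma gram_cauchy_schwarz:
  assumes A: "A \<in> V" and B: "B \<in> V" and C: "C \<in> V"
  shows "(cmod (F A B * F C C - F A C * F C B))\<^sup>2
    \<le> (Re (F A A) * Re (F C C) - (cmod (F A C))\<^sup>2) * (Re (F B B) * Re (F C C) - (cmod (F B C))\<^sup>2)"
proof -
  let ?c = "Re (F C C)"
  \<comment> \<open>The component of \<open>D\<close> orthogonal to \<open>C\<close>, multiplied by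
    \<open>F C C\<close> to avoid a division. It satisfies \<open>F (orth D) C = 0\<close>.\<close>
  define orth where "orth D = (\<lambda>x. of_real ?c *\<^sub>C D x + (- F D C) *\<^sub>C C x)" for D
  have orth: "orth D \<in> V" if "D \<in> V" for D
    unfolding orth_def using that C by (rule lincomb)
  have orth_F: "F (orth D) (orth D') = of_real ?c * (F D D' * F C C - F D C * F C D')"
    if D: "D \<in> V" and D': "D' \<in> V" for D D'
    unfolding orth_def lincomb_lincomb[OF D C D' C] using self[OF C]
    by (simp add: commute[OF C D'] commute[OF C C, symmetric] algebra_simps)
  have orth_self: "Re (F (orth D) (orth D)) = ?c * (Re (F D D) * ?c - (cmod (F D C))\<^sup>2)"
    if D: "D \<in> V" for D
  proof -
    have "F D D * F C C - F D C * F C D = of_real (Re (F D D) * ?c - (cmod (F D C))\<^sup>2)"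
      using self[OF D] self[OF C] complex_norm_square[of "F D C"] commute[OF C D] by simp
    then show ?thesis
      unfolding orth_F[OF D D] by (simp only: of_real_mult[symmetric] Re_complex_of_real)
  qed
  show ?thesis
  proof (cases "?c = 0")
    case True
    \<comment> \<open>A null vector \<open>C\<close> is orthogonal to everything by Cauchy-Schwarz,
      so both sides vanish.\<close>
    then have "F A C = 0" "F B C = 0" "F C C = 0"
      using cauchy_schwarz[OF A C] cauchy_schwarz[OF B C] self[OF C] by auto
    then show ?thesis by simp
  next
    case False
    then have "?c\<^sup>2 > 0"
      by simp
    moreover have "?c\<^sup>2 * (cmod (F A B * F C C - F A C * F C B))\<^sup>2
      \<le> ?c\<^sup>2 * ((Re (F A A) * ?c - (cmod (F A C))\<^sup>2) * (Re (F B B) * ?c - (cmod (F B C))\<^sup>2))"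
      using cauchy_schwarz[OF orth[OF A] orth[OF B]]
      unfolding orth_F[OF A B] orth_self[OF A] orth_self[OF B]
      by (simp add: norm_mult power_mult_distrib power2_eq_square[of ?c] ac_simps)
    ultimately show ?thesis
      by (rule mult_left_le_imp_le[rotated])
  qed
qed

lemma gram_triangle:
  assumes A: "A \<in> V" and B: "B \<in> V" and C: "C \<in> V"
  shows "cmod (F A B) * Re (F C C)
    \<le> cmod (F A B * F C C - F A C * F C B) + cmod (F A C * F C B)"
proof -
  have "cmod (F A B) * Re (F C C) = cmod (F A B * F C C)"
    using nonneg[OF C] by (subst self[OF C]) (simp add: norm_mult)
  then show ?thesis
    using norm_triangle_sub[of "F A B * F C C" "F A C * F C B"] by simp
qed

lemma gram_le:
  assumes A: "A \<in> V" and B: "B \<in> V" and C: "C \<in> V"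
  shows "cmod (F A B * F C C - F A C * F C B) + cmod (F A C * F C B)
    \<le> sqrt (Re (F A A)) * sqrt (Re (F B B)) * Re (F C C)"
proof -
  define p q r where "p = sqrt (Re (F A A))" and "q = sqrt (Re (F B B))" and "r = sqrt (Re (F C C))"
  have sq: "Re (F A A) = p\<^sup>2" "Re (F B B) = q\<^sup>2" "Re (F C C) = r\<^sup>2"
    using nonneg A B C by (simp_all add: p_def q_def r_def)
  define u v where "u = cmod (F A C)" and "v = cmod (F B C)"
  have uv: "0 \<le> u" "u \<le> p * r" "0 \<le> v" "v \<le> q * r"
    using cmod_le A B C by (simp_all add: u_def v_def p_def q_def r_def)
  have "(cmod (F A B * F C C - F A C * F C B))\<^sup>2 \<le> ((p * r)\<^sup>2 - u\<^sup>2) * ((q * r)\<^sup>2 - v\<^sup>2)"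
    using gram_cauchy_schwarz[OF A B C] by (simp add: sq u_def v_def power_mult_distrib)
  \<comment> \<open>A Lagrange-type identity: the product of two differences of squares is a square
    minus a square, and dropping the second leaves a bound whose root can be taken.\<close>
  also have "\<dots> = ((p * r) * (q * r) - u * v)\<^sup>2 - ((p * r) * v - u * (q * r))\<^sup>2"
    by (simp add: power2_eq_square algebra_simps)
  also have "\<dots> \<le> ((p * r) * (q * r) - u * v)\<^sup>2"
    by simp
  finally have "cmod (F A B * F C C - F A C * F C B) \<le> (p * r) * (q * r) - u * v"
    by (rule power2_le_imp_le) (use uv in \<open>auto intro: mult_mono\<close>)
  then have "cmod (F A B * F C C - F A C * F C B) + u * v \<le> p * q * Re (F C C)"
    by (simp add: sq(3) power2_eq_square ac_simps)
  then show ?thesis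
    by (simp add: norm_mult cmod_commute[OF C B] p_def q_def u_def v_def)
qed

text \<open>The reverse triangle inequality bounds the first term of \<open>gram_le\<close> from
  below, so that the product \<open>F A C * F C B\<close> is counted twice; this is the source of
  the factor 1/2.\<close>

lemma buzano:
  assumes A: "A \<in> V" and B: "B \<in> V" and C: "C \<in> V"
  shows "cmod (F A C * F C B)
    \<le> 1 / 2 * (sqrt (Re (F A A)) * sqrt (Re (F B B)) + cmod (F A B)) * Re (F C C)"
proof -
  have "cmod (F A B) * Re (F C C) = cmod (F A B * F C C)"
    using nonneg[OF C] by (subst self[OF C]) (simp add: norm_mult)
  then have "cmod (F A C * F C B) - cmod (F A B) * Re (F C C)
      \<le> cmod (F A B * F C C - F A C * F C B)"
    using norm_triangle_ineq2[of "F A C * F C B" "F A B * F C C"] by (simp add: norm_minus_commute)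
  then show ?thesis
    using gram_le[OF A B C] by (simp add: algebra_simps)
qed

end

section \<open>The trace form of a positive operator and the resulting inequalities\<close>

lemma positive_opD:
  fixes P :: "'a::complex_hilbert \<Rightarrow> 'a" and E :: "'a set"
  assumes "positive_op P" "orthonormal_basis E"
  shows "bounded_clinear P" "cinner (P x) y = cinner x (P y)" "0 \<le> Re (cinner (P x) x)"
  using assms cinner_cadjoint[OF assms(2), of P] by (auto simp: positive_op_def)

lemma summable_norm_comp:
  assumes P: "bounded_clinear P" and "(\<lambda>e. (norm (A e))\<^sup>2) summable_on E"
  shows "(\<lambda>e. (norm ((P \<circ> A) e))\<^sup>2) summable_on E"
proof -
  obtain K where K: "K > 0" "\<And>x. norm (P x) \<le> K * norm x"
    using bounded_clinear_bound[OF P] by blast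
  show ?thesis
  proof (rule summable_on_comparison_test)
    show "(\<lambda>e. K\<^sup>2 * (norm (A e))\<^sup>2) summable_on E"
      using assms(2) by (rule summable_on_cmult_right)
    show "(norm ((P \<circ> A) e))\<^sup>2 \<le> K\<^sup>2 * (norm (A e))\<^sup>2" for e
      using power_mono[OF K(2)[of "A e"], of 2] by (simp add: power_mult_distrib)
  qed simp
qed

text \<open>Moves the adjoint to the other side inside the trace. A Hilbert-Schmidt operator comes
  with an orthonormal basis, so the set chosen in \<open>trace_op\<close> is a genuine
  basis.\<close>

lemma has_sum_trace_form:
  fixes P :: "'a::complex_hilbert \<Rightarrow> 'a"
  assumes P: "bounded_clinear P" and A: "A \<in> hilbert_schmidt" and B: "B \<in> hilbert_schmidt"
  shows "((\<lambda>e. cinner (P (A e)) (B e)) has_sum trace_op (P \<circ> A \<circ> cadjoint B))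
    (SOME E. orthonormal_basis E)"
proof -
  let ?E = "SOME E :: 'a set. orthonormal_basis E"
  have E: "orthonormal_basis ?E"
    using A by (intro someI_ex[of orthonormal_basis]) (auto simp: hilbert_schmidt_def)
  note hs = A[unfolded hilbert_schmidt_iff[OF E]] B[unfolded hilbert_schmidt_iff[OF E]]
  obtain s where s: "((\<lambda>f. cinner ((P \<circ> A) f) (B f)) has_sum s) ?E"
      "((\<lambda>e. cinner ((P \<circ> A) (cadjoint B e)) e) has_sum s) ?E"
    using has_sum_comp_cadjoint[OF E bounded_clinear_compose[OF P, of A] _ summable_norm_comp[OF P]] hs
    by blast
  then show ?thesis
    by (simp add: trace_op_def infsumI)
qed

text \<open>With the trace written as the series of \<open>cinner (P (A e)) (B e)\<close>, the
  axioms hold term by term: linearity from that of \<open>P\<close>, Hermitian symmetry from its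
  symmetry, nonnegativity from its positivity.\<close>

lemma semi_inner_form_trace:
  fixes P :: "'a::complex_hilbert \<Rightarrow> 'a" and E :: "'a set"
  assumes P: "positive_op P" and E: "orthonormal_basis E"
  shows "semi_inner_form hilbert_schmidt (\<lambda>A B. trace_op (P \<circ> A \<circ> cadjoint B))"
proof
  note pos = positive_opD[OF P E]
  note trace = has_sum_trace_form[OF pos(1)]
  fix A B :: "'a \<Rightarrow> 'a"
  assume A: "A \<in> hilbert_schmidt" and B: "B \<in> hilbert_schmidt"
  note hs = A[unfolded hilbert_schmidt_iff[OF E]] B[unfolded hilbert_schmidt_iff[OF E]]
  show lincomb: "(\<lambda>x. a *\<^sub>C A x + b *\<^sub>C B x) \<in> hilbert_schmidt" for a b
    unfolding hilbert_schmidt_iff[OF E]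
  proof
    show "bounded_clinear (\<lambda>x. a *\<^sub>C A x + b *\<^sub>C B x)"
      using hs by (intro bounded_clinear_lincomb) auto
    show "(\<lambda>e. (norm (a *\<^sub>C A e + b *\<^sub>C B e))\<^sup>2) summable_on E"
    proof (rule summable_on_comparison_test)
      show "(\<lambda>e. 2 * (cmod a)\<^sup>2 * (norm (A e))\<^sup>2 + 2 * (cmod b)\<^sup>2 * (norm (B e))\<^sup>2) summable_on E"
        using hs by (intro summable_on_add summable_on_cmult_right) auto
      show "(norm (a *\<^sub>C A e + b *\<^sub>C B e))\<^sup>2
          \<le> 2 * (cmod a)\<^sup>2 * (norm (A e))\<^sup>2 + 2 * (cmod b)\<^sup>2 * (norm (B e))\<^sup>2" for e
      proof -
        have "(norm (a *\<^sub>C A e + b *\<^sub>C B e))\<^sup>2 \<le> (norm (a *\<^sub>C A e) + norm (b *\<^sub>C B e))\<^sup>2"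
          by (intro power_mono norm_triangle_ineq) auto
        also have "\<dots> \<le> 2 * (norm (a *\<^sub>C A e))\<^sup>2 + 2 * (norm (b *\<^sub>C B e))\<^sup>2"
          using sum_squares_bound[of "norm (a *\<^sub>C A e)" "norm (b *\<^sub>C B e)"] by (simp add: power2_sum)
        finally show ?thesis
          by (simp add: norm_scaleC power_mult_distrib)
      qed
    qed simp
  qed
  show "trace_op (P \<circ> (\<lambda>x. a *\<^sub>C A x + b *\<^sub>C B x) \<circ> cadjoint C)
      = a * trace_op (P \<circ> A \<circ> cadjoint C) + b * trace_op (P \<circ> B \<circ> cadjoint C)"
    if C: "C \<in> hilbert_schmidt" for a b C
  proof (rule has_sum_unique[OF trace[OF lincomb C]])
    show "((\<lambda>e. cinner (P (a *\<^sub>C A e + b *\<^sub>C B e)) (C e)) has_sum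
        a * trace_op (P \<circ> A \<circ> cadjoint C) + b * trace_op (P \<circ> B \<circ> cadjoint C))
        (SOME E. orthonormal_basis E)"
      using has_sum_add[OF has_sum_cmult_right[OF trace[OF A C]] has_sum_cmult_right[OF trace[OF B C]], of a b]
      by (simp add: linear_simps(1)[OF bounded_clinearD(1)[OF pos(1)]] bounded_clinearD(2)[OF pos(1)]
          cinner_add_left cinner_scaleC_left)
  qed
  show "trace_op (P \<circ> A \<circ> cadjoint B) = cnj (trace_op (P \<circ> B \<circ> cadjoint A))"
  proof (rule has_sum_unique[OF trace[OF A B]])
    have "cinner (P (A e)) (B e) = cnj (cinner (P (B e)) (A e))" for e
      by (simp only: pos(2) cinner_commute[symmetric])
    then show "((\<lambda>e. cinner (P (A e)) (B e)) has_sum cnj (trace_op (P \<circ> B \<circ> cadjoint A)))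
        (SOME E. orthonormal_basis E)"
      using trace[OF B A] by simp
  qed
  show "0 \<le> Re (trace_op (P \<circ> A \<circ> cadjoint A))"
    using has_sum_Re[OF trace[OF A A]] by (rule has_sum_nonneg) (rule pos(3))
qed

theorem theorem4:
  fixes P :: "'a::complex_hilbert \<Rightarrow> 'a"
  assumes "positive_op P"
  shows "(\<forall>A\<in>hilbert_schmidt. \<forall>B\<in>hilbert_schmidt.
      (cmod (trace_op (P \<circ> A \<circ> cadjoint B)))\<^sup>2
        \<le> Re (trace_op (P \<circ> modulus (cadjoint A) ^^ 2)) * Re (trace_op (P \<circ> modulus (cadjoint B) ^^ 2)) \<and>
      sqrt (Re (trace_op (P \<circ> modulus (cadjoint A) ^^ 2))
          + 2 * Re (trace_op (P \<circ> A \<circ> cadjoint B))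
          + Re (trace_op (P \<circ> modulus (cadjoint B) ^^ 2)))
        \<le> sqrt (Re (trace_op (P \<circ> modulus (cadjoint A) ^^ 2)))
          + sqrt (Re (trace_op (P \<circ> modulus (cadjoint B) ^^ 2)))) \<and>
    (\<forall>A\<in>hilbert_schmidt. \<forall>B\<in>hilbert_schmidt. \<forall>C\<in>hilbert_schmidt.
      (cmod (trace_op (P \<circ> A \<circ> cadjoint B) * trace_op (P \<circ> modulus (cadjoint C) ^^ 2)
           - trace_op (P \<circ> A \<circ> cadjoint C) * trace_op (P \<circ> C \<circ> cadjoint B)))\<^sup>2
        \<le> (Re (trace_op (P \<circ> modulus (cadjoint A) ^^ 2)) * Re (trace_op (P \<circ> modulus (cadjoint C) ^^ 2))
            - (cmod (trace_op (P \<circ> A \<circ> cadjoint C)))\<^sup>2)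
          * (Re (trace_op (P \<circ> modulus (cadjoint B) ^^ 2)) * Re (trace_op (P \<circ> modulus (cadjoint C) ^^ 2))
            - (cmod (trace_op (P \<circ> B \<circ> cadjoint C)))\<^sup>2) \<and>
      cmod (trace_op (P \<circ> A \<circ> cadjoint B)) * Re (trace_op (P \<circ> modulus (cadjoint C) ^^ 2))
        \<le> cmod (trace_op (P \<circ> A \<circ> cadjoint B) * trace_op (P \<circ> modulus (cadjoint C) ^^ 2)
           - trace_op (P \<circ> A \<circ> cadjoint C) * trace_op (P \<circ> C \<circ> cadjoint B))
          + cmod (trace_op (P \<circ> A \<circ> cadjoint C) * trace_op (P \<circ> C \<circ> cadjoint B)) \<and>
      cmod (trace_op (P \<circ> A \<circ> cadjoint B) * trace_op (P \<circ> modulus (cadjoint C) ^^ 2)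
           - trace_op (P \<circ> A \<circ> cadjoint C) * trace_op (P \<circ> C \<circ> cadjoint B))
          + cmod (trace_op (P \<circ> A \<circ> cadjoint C) * trace_op (P \<circ> C \<circ> cadjoint B))
        \<le> sqrt (Re (trace_op (P \<circ> modulus (cadjoint A) ^^ 2)))
          * sqrt (Re (trace_op (P \<circ> modulus (cadjoint B) ^^ 2)))
          * Re (trace_op (P \<circ> modulus (cadjoint C) ^^ 2)) \<and>
      cmod (trace_op (P \<circ> A \<circ> cadjoint C) * trace_op (P \<circ> C \<circ> cadjoint B))
        \<le> 1 / 2 * (sqrt (Re (trace_op (P \<circ> modulus (cadjoint A) ^^ 2)))
            * sqrt (Re (trace_op (P \<circ> modulus (cadjoint B) ^^ 2)))
            + cmod (trace_op (P \<circ> A \<circ> cadjoint B)))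
          * Re (trace_op (P \<circ> modulus (cadjoint C) ^^ 2)))"
proof (cases "\<exists>E :: 'a set. orthonormal_basis E")
  case True
  then obtain E :: "'a set" where E: "orthonormal_basis E" ..
  interpret semi_inner_form hilbert_schmidt "\<lambda>A B. trace_op (P \<circ> A \<circ> cadjoint B)"
    using assms E by (rule semi_inner_form_trace)
  \<comment> \<open>This rewrites the traces with squared moduli as diagonal values of the form,
    after which each conjunct is an inequality of the locale.\<close>
  have mod: "P \<circ> modulus (cadjoint A) ^^ 2 = P \<circ> A \<circ> cadjoint A" if "A \<in> hilbert_schmidt" for A
  proof -
    have A: "bounded_clinear A"
      using that by (simp add: hilbert_schmidt_def)
    show ?thesis
      unfolding modulus_square[OF E bounded_clinear_cadjoint[OF E A]] cadjoint_cadjoint[OF E A]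
      by (rule o_assoc)
  qed
  show ?thesis
    by (intro conjI ballI; simp only: mod;
        rule cauchy_schwarz triangle gram_cauchy_schwarz gram_triangle gram_le buzano; assumption)
\<comment> \<open>Without an orthonormal basis \<open>hilbert_schmidt\<close> is empty by
  definition, and all claims are vacuous.\<close>
qed (auto simp: hilbert_schmidt_def)

end
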